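(* Let $k\in\mathbb{N}$, $0<\tau\le 1$, $0<\mu\le 1$, $0\le\tau-\mu<1$, $0\le\delta<1$, $0\le\gamma<1$ and $\tau-\mu+\gamma<1$. If $f\in\mathcal{P}_{\tau,\mu}(k,\delta,\gamma)$, then for all $z\in\mathbb{U}$ $$|z|-|z|^{k+1}\frac{(1-\gamma)(\mu+1)_k}{(1+\delta k)(\tau+1)_k}\le|f(z)|\le|z|+|z|^{k+1}\frac{(1-\gamma)(\mu+1)_k}{(1+\delta k)(\tau+1)_k}.$$
   Context: $\mathbb{U}=\{z\in\mathbb{C}:|z|<1\}$, $\mathbb{N}=\{1,2,3,\dots\}$. For $k\in\mathbb{N}$, $\mathcal{P}(k)$ is the class of functions that are analytic and univalent in $\mathbb{U}$ and of the form $f(z)=z-\sum_{\nu=k+1}^{\infty}a_\nu z^\nu$ with all $a_\nu\ge 0$. Srivastava-Owa fractional derivative: for $0\le\varsigma<1$, $\mathfrak{D}_z^{\varsigma}g(z)=\frac{1}{\Gamma(1-\varsigma)}\frac{d}{dz}\int_0^z g(\zeta)(z-\zeta)^{-\varsigma}\,d\zeta$, where the multiplicity of $(z-\zeta)^{-\varsigma}$ is removed by requiring $\log(z-\zeta)$ to be real when $z-\zeta>0$. Tremblay operator: for $0<\tau\le 1$, $0<\mu\le 1$, $0\le\tau-\mu<1$, $\mathfrak{T}^{\tau,\mu}f(z)=\frac{\Gamma(\mu)}{\Gamma(\tau)}z^{1-\mu}\,\mathfrak{D}_z^{\tau-\mu}\big[z^{\tau-1}f(z)\big]$ for $z\in\mathbb{U}$.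 (Powers of $z$ and $\zeta$ are taken with the principal branch and the integral along the segment from $0$ to $z$; the resulting function is understood as extended analytically to all of $\mathbb{U}$, including $z=0$ and the negative real axis.) Class $\mathcal{P}_{\tau,\mu}(k,\delta,\gamma)$ (with $0<\tau\le1$, $0<\mu\le1$, $0\le\tau-\mu<1$, $0\le\delta<1$, $0\le\gamma<1$, $\tau-\mu+\gamma<1$): the set of $f\in\mathcal{P}(k)$ such that for all $z\in\mathbb{U}$ $$\Re\left(\frac{\Gamma(\mu+1)\Gamma(\tau)}{\Gamma(\tau+1)\Gamma(\mu)}z^{-1}\left[(1-\delta)\mathfrak{T}^{\tau,\mu}f(z)+\delta z\big(\mathfrak{T}^{\tau,\mu}f\big)'(z)\right]\right)>\gamma,$$ the value at $z=0$ being understood by removing the singularity. Pochhammer symbol: $(\lambda)_0=1$ and $(\lambda)_k=\lambda(\lambda+1)\cdots(\lambda+k-1)$ for $k\in\mathbb{N}$. *)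

theory Defs
  imports "HOL-Complex_Analysis.Complex_Analysis"
begin

text \<open>
  The class \<open>\<P>(k)\<close>. Only the values of \<open>f\<close> on the open unit disc matter.
\<close>

definition class_P :: "nat \<Rightarrow> (complex \<Rightarrow> complex) set" where
  "class_P k = {f. f holomorphic_on ball 0 1 \<and> inj_on f (ball 0 1) \<and>
     (\<exists>a :: nat \<Rightarrow> real. (\<forall>\<nu>\<ge>k+1. 0 \<le> a \<nu>) \<and>
        (\<forall>z\<in>ball 0 1. summable (\<lambda>n. complex_of_real (a (n + (k+1))) * z ^ (n + (k+1))) \<and>
           f z = z - (\<Sum>n. complex_of_real (a (n + (k+1))) * z ^ (n + (k+1)))))}"

text \<open>
  The Srivastava--Owa fractional derivative of order \<open>0 \<le> \<sigma> < 1\<close>, with the integral taken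
  along the segment from \<open>0\<close> to \<open>z\<close>. \<open>powr\<close> on complex numbers is the principal branch;
  it takes the value \<open>0\<close> at base \<open>0\<close>, which only affects the endpoints of the segment.
\<close>

definition frac_deriv :: "real \<Rightarrow> (complex \<Rightarrow> complex) \<Rightarrow> complex \<Rightarrow> complex" where
  "frac_deriv \<sigma> g z = 1 / complex_of_real (Gamma (1 - \<sigma>)) *
     deriv (\<lambda>w. contour_integral (linepath 0 w)
                  (\<lambda>\<zeta>. g \<zeta> * (w - \<zeta>) powr (- complex_of_real \<sigma>))) z"

definition tremblay_formula ::
    "real \<Rightarrow> real \<Rightarrow> (complex \<Rightarrow> complex) \<Rightarrow> complex \<Rightarrow> complex" where
  "tremblay_formula \<tau> \<mu> f z =
     complex_of_real (Gamma \<mu> / Gamma \<tau>) * z powr (1 - complex_of_real \<mu>) *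
     frac_deriv (\<tau> - \<mu>) (\<lambda>\<zeta>. \<zeta> powr (complex_of_real \<tau> - 1) * f \<zeta>) z"

text \<open>
  With principal branches the formula is meaningful on the disc slit along the nonpositive
  real axis. The Tremblay operator is the analytic extension of it to the whole disc, which
  is unique there; the values of the chosen function off the disc are irrelevant.
\<close>

definition tremblay :: "real \<Rightarrow> real \<Rightarrow> (complex \<Rightarrow> complex) \<Rightarrow> complex \<Rightarrow> complex" where
  "tremblay \<tau> \<mu> f = (SOME T. T holomorphic_on ball 0 1 \<and>
     (\<forall>z\<in>ball 0 1 - \<real>\<^sub>\<le>\<^sub>0. T z = tremblay_formula \<tau> \<mu> f z))"

text \<open>\<open>remove_sings\<close> supplies the limit value at the removable singularity \<open>z = 0\<close>.\<close>

definition class_P_tremblay ::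
    "real \<Rightarrow> real \<Rightarrow> nat \<Rightarrow> real \<Rightarrow> real \<Rightarrow> (complex \<Rightarrow> complex) set" where
  "class_P_tremblay \<tau> \<mu> k \<delta> \<gamma> = {f \<in> class_P k. \<forall>z\<in>ball 0 1.
     Re (remove_sings (\<lambda>w.
           complex_of_real (Gamma (\<mu> + 1) * Gamma \<tau> / (Gamma (\<tau> + 1) * Gamma \<mu>)) * inverse w *
           ((1 - complex_of_real \<delta>) * tremblay \<tau> \<mu> f w
             + complex_of_real \<delta> * w * deriv (tremblay \<tau> \<mu> f) w)) z) > \<gamma>}"

end

theory Submission
  imports Defs
begin

text \<open>
  On a power series the Tremblay operator acts coefficientwise: substituting \<open>\<zeta> = t w\<close> turns
  the fractional integral of \<open>\<zeta>\<^bsup>\<tau>-1\<^esup> \<zeta>\<^sup>n\<close> into a Beta integral, and \<open>T z\<^sup>n\<close> is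
  \<open>\<Gamma>(\<mu>) \<Gamma>(n + \<tau>) / (\<Gamma>(\<tau>) \<Gamma>(n + \<mu>)) z\<^sup>n\<close>. Letting \<open>z\<close> tend to \<open>1\<close> along the
  positive reals in the condition defining the class gives
  \<open>\<Sum> (1 + \<delta> (\<nu> - 1)) (\<tau>+1)\<^bsub>\<nu>-1\<^esub> / (\<mu>+1)\<^bsub>\<nu>-1\<^esub> a\<^bsub>\<nu>\<^esub> \<le> 1 - \<gamma>\<close>. The weights increase with \<open>\<nu>\<close> because
  \<open>\<mu> \<le> \<tau>\<close>, so dividing by the first one bounds \<open>\<Sum> a\<^bsub>\<nu>\<^esub>\<close>, and
  \<open>\<bar>f(z) - z\<bar> \<le> \<bar>z\<bar>\<^bsup>k+1\<^esup> \<Sum> a\<^bsub>\<nu>\<^esub>\<close>.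
\<close>

section \<open>Power series on the unit disc and their Beta-weighted integrals\<close>

text \<open>Termwise differentiation, in the form of the Euler operator z d/dz: it keeps every
  exponent and multiplies the n-th coefficient by n. Both the fractional derivative and the
  condition defining the class are combinations of g and z g'.\<close>

lemma powser_disc_derivative:
  fixes c :: "nat \<Rightarrow> complex"
  assumes sums: "\<And>z. norm z < 1 \<Longrightarrow> (\<lambda>n. c n * z ^ n) sums g z" and z: "norm z < 1"
  shows "(g has_field_derivative deriv g z) (at z)"
    and "(\<lambda>n. of_nat n * c n * z ^ n) sums (z * deriv g z)"
proof -
  have "((\<lambda>z. \<Sum>n. c n * z ^ n) has_field_derivative (\<Sum>n. diffs c n * z ^ n)) (at z)"
    by (rule termdiffs_strong'[of 1]) (use sums z in \<open>auto dest: sums_summable\<close>)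
  then have "(g has_field_derivative (\<Sum>n. diffs c n * z ^ n)) (at z)"
    by (rule has_field_derivative_transform_within_open[where S = "ball 0 1"])
      (use z sums in \<open>auto simp: sums_iff\<close>)
  then show g: "(g has_field_derivative deriv g z) (at z)"
    using DERIV_imp_deriv by metis
  have "(\<lambda>n. diffs c n * z ^ n) sums deriv g z"
    by (rule termdiffs_sums_strong[OF sums g z])
  then have "(\<lambda>n. z * (diffs c n * z ^ n)) sums (z * deriv g z)"
    by (rule sums_mult)
  then have "(\<lambda>n. of_nat (Suc n) * c (Suc n) * z ^ Suc n) sums (z * deriv g z)"
    by (simp add: diffs_def mult_ac)
  then show "(\<lambda>n. of_nat n * c n * z ^ n) sums (z * deriv g z)"
    \<comment> \<open>The term of index 0 carries the factor n = 0, so shifting the index back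
      leaves the sum unchanged.\<close>
    by (subst (asm) sums_Suc_iff) simp
qed

lemma powser_disc_holomorphic:
  fixes c :: "nat \<Rightarrow> complex"
  assumes "\<And>z. norm z < 1 \<Longrightarrow> (\<lambda>n. c n * z ^ n) sums g z"
  shows "g holomorphic_on ball 0 1"
  using powser_disc_derivative(1)[OF assms]
  by (metis holomorphic_on_open mem_ball_0 open_ball)

text \<open>Sum and integral are interchanged by dominated convergence. The partial sums are finite
  combinations of Beta integrals, and since t \<le> 1 they are dominated by \<open>W t\<close> times
  the sum of the norms at \<open>w\<close>.\<close>

lemma beta_weighted_powser:
  fixes b :: "nat \<Rightarrow> complex" and a s :: real
  assumes a: "a > 0" and s: "s > 0" and summ: "summable (\<lambda>n. norm (b n * w ^ n))"
  defines "W \<equiv> \<lambda>t. t powr (a - 1) * (1 - t) powr (s - 1)"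
  shows "\<exists>I. ((\<lambda>t. of_real (W t) * (\<Sum>n. b n * (of_real t * w) ^ n)) has_integral I) {0..1} \<and>
             (\<lambda>n. of_real (Beta (real n + a) s) * b n * w ^ n) sums I"
proof -
  \<comment> \<open>The factor t^n is absorbed into the exponent of \<open>powr\<close>, so that
    each summand is literally a Beta integrand; \<open>F_eq\<close> restores the factored
    form.\<close>
  define F where "F = (\<lambda>N t. \<Sum>n<N. of_real (t powr (real n + a - 1) * (1 - t) powr (s - 1)) * (b n * w ^ n))"
  define g where "g = (\<lambda>t. of_real (W t) * (\<Sum>n. b n * (of_real t * w) ^ n))"
  have Fi: "(F N has_integral (\<Sum>n<N. of_real (Beta (real n + a) s) * (b n * w ^ n))) {0..1}" for N
    unfolding F_def
    by (intro has_integral_sum has_integral_mult_left has_integral_of_real has_integral_Beta_real)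
      (use a s in auto)
  have F_eq: "F N t = of_real (W t) * (\<Sum>n<N. b n * (of_real t * w) ^ n)" if "t \<in> {0..1}" for N t
  proof -
    have "t powr (real n + a - 1) = t powr (a - 1) * t ^ n" for n
    \<comment> \<open>At t = 0 both sides vanish, even for n = 0, because
      \<open>0 powr x = 0\<close>.\<close>
    proof (cases "t = 0")
      case False
      with that show ?thesis
        by (simp add: powr_realpow[symmetric] powr_add[symmetric] algebra_simps)
    qed auto
    then show ?thesis
      unfolding F_def W_def sum_distrib_left
      by (intro sum.cong) (auto simp: power_mult_distrib mult_ac)
  qed
  have le: "norm (b n * (of_real t * w) ^ n) \<le> norm (b n * w ^ n)" if "t \<in> {0..1}" for n t
    using that by (auto simp: norm_mult norm_power power_mult_distrib power_le_one
        intro!: mult_left_mono mult_left_le_one_le)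
  have W0: "W t \<ge> 0" for t by (simp add: W_def)
  have h: "(\<lambda>t. W t * (\<Sum>n. norm (b n * w ^ n))) integrable_on {0..1}"
    unfolding W_def using has_integral_Beta_real[OF a s] by (intro integrable_on_mult_left) blast
  have F_le: "norm (F N t) \<le> W t * (\<Sum>n. norm (b n * w ^ n))" if t: "t \<in> {0..1}" for N t
  proof -
    have "norm (\<Sum>n<N. b n * (of_real t * w) ^ n) \<le> (\<Sum>n<N. norm (b n * w ^ n))"
      by (intro sum_norm_le le t)
    also have "\<dots> \<le> (\<Sum>n. norm (b n * w ^ n))"
      by (intro sum_le_suminf summ) auto
    finally show ?thesis
      using W0[of t] by (auto simp: F_eq[OF t] norm_mult intro!: mult_left_mono)
  qed
  have F_lim: "(\<lambda>N. F N t) \<longlonglongrightarrow> g t" if t: "t \<in> {0..1}" for t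
  proof -
    have "summable (\<lambda>n. b n * (of_real t * w) ^ n)"
      by (rule summable_comparison_test'[OF summ, of 0]) (use le[OF t] in auto)
    then show ?thesis
      unfolding F_eq[OF t] g_def by (intro tendsto_mult_left summable_LIMSEQ)
  qed
  have "F N integrable_on {0..1}" for N using Fi by blast
  note dc = dominated_convergence[OF this h F_le F_lim, simplified]
  have "(\<lambda>n. of_real (Beta (real n + a) s) * (b n * w ^ n)) sums integral {0..1} g"
    unfolding sums_def using dc(2) by (simp add: integral_unique[OF Fi])
  with dc(1) show ?thesis
    unfolding g_def by (auto simp: mult.assoc integrable_integral)
qed

section \<open>The Tremblay operator on power series\<close>

text \<open>The fractional integral equals \<open>w powr \<mu>\<close> times a power series
  \<open>P\<close> with coefficients \<open>Beta (n + \<tau>) s * b n\<close>. Differentiating and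
  multiplying by \<open>z powr (1 - \<mu>)\<close> gives \<mu> P + z P', which multiplies the n-th
  coefficient by n + \<mu>. The second conclusion also covers the slit, as the analytic extension
  requires.\<close>

lemma tremblay_formula_sums:
  fixes b :: "nat \<Rightarrow> complex"
  assumes \<tau>: "0 < \<tau>" and \<mu>: "0 < \<mu>" and \<sigma>: "\<tau> - \<mu> < 1"
    and f: "\<And>z. norm z < 1 \<Longrightarrow> (\<lambda>n. b n * z ^ n) sums f z"
    and z: "z \<in> ball 0 1 - \<real>\<^sub>\<le>\<^sub>0"
  defines "c \<equiv> \<lambda>n. of_real (Gamma \<mu> / Gamma \<tau> * (Gamma (real n + \<tau>) / Gamma (real n + \<mu>))) * b n"
  shows "(\<lambda>n. c n * z ^ n) sums tremblay_formula \<tau> \<mu> f z"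
    and "\<And>z. norm z < 1 \<Longrightarrow> summable (\<lambda>n. c n * z ^ n)"
proof -
  define s where "s = 1 - (\<tau> - \<mu>)"
  have s: "s > 0" using \<sigma> by (simp add: s_def)
  define W where "W = (\<lambda>t. t powr (\<tau> - 1) * (1 - t) powr (s - 1))"
  define d where "d = (\<lambda>n. of_real (Beta (real n + \<tau>) s) * b n)"
  define P where "P = (\<lambda>w. \<Sum>n. d n * w ^ n)"
  have suminf_f: "(\<Sum>n. b n * z ^ n) = f z" if "norm z < 1" for z
    using f[OF that] by (simp add: sums_iff)
  have abs: "summable (\<lambda>n. norm (b n * w ^ n))" if w: "norm w < 1" for w
  proof -
    \<comment> \<open>Convergence at a radius strictly between |w| and 1 gives absolute convergence
      at \<open>w\<close>.\<close>
    obtain r where r: "norm w < r" "r < 1" using dense[OF w] by blast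
    moreover from this have "r \<ge> 0" using norm_ge_zero[of w] by linarith
    ultimately have r': "norm w < norm (complex_of_real r)" "norm (complex_of_real r) < 1" by simp_all
    show ?thesis
      by (rule powser_insidea[OF sums_summable[OF f[OF r'(2)]] r'(1)])
  qed
  have int: "((\<lambda>t. of_real (W t) * f (of_real t * w)) has_integral P w) {0..1}"
    and P: "(\<lambda>n. d n * w ^ n) sums P w" if w: "norm w < 1" for w
  proof -
    obtain I where I: "((\<lambda>t. of_real (W t) * (\<Sum>n. b n * (of_real t * w) ^ n)) has_integral I) {0..1}"
      "(\<lambda>n. d n * w ^ n) sums I"
      using beta_weighted_powser[OF \<tau> s abs[OF w]] unfolding W_def d_def by blast
    have "P w = I" using I(2) by (simp add: P_def sums_iff)
    with I(2) show "(\<lambda>n. d n * w ^ n) sums P w" by simp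
    have "norm (of_real t * w) < 1" if "t \<in> {0..1}" for t
      using that w by (auto simp: norm_mult intro: le_less_trans[OF mult_left_le_one_le])
    then have "of_real (W t) * (\<Sum>n. b n * (of_real t * w) ^ n) = of_real (W t) * f (of_real t * w)"
      if "t \<in> {0..1}" for t
      using that by (simp only: suminf_f)
    then show "((\<lambda>t. of_real (W t) * f (of_real t * w)) has_integral P w) {0..1}"
      by (rule has_integral_eq) (use I(1) \<open>P w = I\<close> in auto)
  qed
  \<comment> \<open>Principal powers split over a product when one factor is a nonnegative real, so
    the powers of \<open>w\<close> leave the integral. Their exponents are \<tau> - 1 and -(\<tau> -
    \<mu>), and the derivative of the segment adds 1, for a total of \<mu>.\<close>
  have contour: "contour_integral (linepath 0 w)
       (\<lambda>\<zeta>. \<zeta> powr (of_real \<tau> - 1) * f \<zeta> * (w - \<zeta>) powr (- of_real (\<tau> - \<mu>)))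
       = w powr of_real \<mu> * P w" if w: "w \<in> ball 0 1 - \<real>\<^sub>\<le>\<^sub>0" for w
  proof -
    have w0: "w \<noteq> 0" using w by auto
    have weighted: "((\<lambda>t. w powr of_real \<mu> * (of_real (W t) * f (of_real t * w))) has_integral
        (w powr of_real \<mu> * P w)) {0..1}"
      using int w by (intro has_integral_mult_right) auto
    have "((\<lambda>t. linepath 0 w t powr (of_real \<tau> - 1) * f (linepath 0 w t) *
        (w - linepath 0 w t) powr (- of_real (\<tau> - \<mu>)) * (w - 0)) has_integral (w powr of_real \<mu> * P w)) {0..1}"
    proof (rule has_integral_eq[OF _ weighted])
      fix t :: real assume t: "t \<in> {0..1}"
      have lin: "linepath 0 w t = of_real t * w"
        by (simp add: linepath_def scaleR_conv_of_real)
      have 1: "(of_real t * w) powr (of_real \<tau> - 1) = of_real (t powr (\<tau> - 1)) * w powr (of_real \<tau> - 1)"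
        using t powr_of_real[of t "\<tau> - 1"] by (simp add: powr_times_real_left)
      have "of_real (1 - t) powr (- of_real (\<tau> - \<mu>)) = complex_of_real ((1 - t) powr (s - 1))"
        using t powr_of_real[of "1 - t" "s - 1"] by (simp add: s_def)
      moreover have "w - of_real t * w = of_real (1 - t) * w" by (simp add: algebra_simps)
      moreover have "(of_real (1 - t) * w) powr (- of_real (\<tau> - \<mu>)) =
          of_real (1 - t) powr (- of_real (\<tau> - \<mu>)) * w powr (- of_real (\<tau> - \<mu>))"
        using t by (intro powr_times_real_left) auto
      ultimately have 2: "(w - of_real t * w) powr (- of_real (\<tau> - \<mu>)) =
          of_real ((1 - t) powr (s - 1)) * w powr (- of_real (\<tau> - \<mu>))"
        by (simp only:)
      have 3: "w powr of_real \<mu> = w powr (of_real \<tau> - 1) * w powr (- of_real (\<tau> - \<mu>)) * w"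
      proof -
        have "w powr (of_real \<tau> - 1) * w powr (- of_real (\<tau> - \<mu>)) * w powr 1
            = w powr (of_real \<tau> - 1 + - of_real (\<tau> - \<mu>) + 1)"
          by (simp only: powr_add)
        with w0 show ?thesis by simp
      qed
      show "w powr of_real \<mu> * (of_real (W t) * f (of_real t * w)) =
        linepath 0 w t powr (of_real \<tau> - 1) * f (linepath 0 w t) *
        (w - linepath 0 w t) powr (- of_real (\<tau> - \<mu>)) * (w - 0)"
        unfolding 3 lin 1 2 W_def by (simp only: of_real_mult mult_ac diff_zero)
    qed
    then show ?thesis
      by (intro contour_integral_unique iffD2[OF has_contour_integral_linepath])
  qed
  define K where "K = complex_of_real (Gamma \<mu> / Gamma \<tau>) / of_real (Gamma s)"
  \<comment> \<open>Since \<tau> + s = \<mu> + 1, the denominator of the Beta value is \<Gamma>(n +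
    \<mu> + 1); the factor n + \<mu> lowers it to \<Gamma>(n + \<mu>), and \<open>K\<close> cancels
    \<Gamma>(s).\<close>
  have d_eq: "K * ((of_nat n + of_real \<mu>) * d n) = c n" for n
  proof -
    have "real n + \<tau> + s = (real n + \<mu>) + 1" by (simp add: s_def)
    moreover have "Gamma ((real n + \<mu>) + 1) = (real n + \<mu>) * Gamma (real n + \<mu>)"
      using \<mu> by (intro Gamma_plus1) (auto dest: nonpos_Ints_nonpos)
    ultimately have "Gamma (real n + \<tau> + s) = (real n + \<mu>) * Gamma (real n + \<mu>)"
      by (simp only:)
    moreover have "Gamma s \<noteq> 0" "real n + \<mu> \<noteq> 0" "Gamma (real n + \<mu>) \<noteq> 0"
      using s \<mu> by (auto simp: Gamma_eq_zero_iff dest!: nonpos_Ints_nonpos)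
    ultimately have "Gamma \<mu> / Gamma \<tau> / Gamma s * ((real n + \<mu>) * Beta (real n + \<tau>) s) =
        Gamma \<mu> / Gamma \<tau> * (Gamma (real n + \<tau>) / Gamma (real n + \<mu>))"
      by (simp add: Beta_def)
    then have "complex_of_real (Gamma \<mu> / Gamma \<tau> / Gamma s * ((real n + \<mu>) * Beta (real n + \<tau>) s)) * b n = c n"
      by (simp only: c_def)
    then show ?thesis
      by (simp add: d_def K_def mult_ac)
  qed
  have c_sums: "(\<lambda>n. c n * z ^ n) sums
      (K * (of_real \<mu> * P z + z * deriv P z))"
    if "norm z < 1" for z
  proof -
    have "(\<lambda>n. of_real \<mu> * (d n * z ^ n) + of_nat n * d n * z ^ n) sums (of_real \<mu> * P z + z * deriv P z)"
      by (intro sums_add sums_mult P powser_disc_derivative(2)[OF P] that)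
    from sums_mult[OF this, of K]
    show ?thesis
      unfolding d_eq[symmetric] by (simp add: algebra_simps)
  qed
  then show "\<And>z. norm z < 1 \<Longrightarrow> summable (\<lambda>n. c n * z ^ n)" by (blast dest: sums_summable)
  have nz: "norm z < 1" and z0: "z \<noteq> 0" and zR: "z \<notin> \<real>\<^sub>\<le>\<^sub>0" using z by auto
  have "((\<lambda>w. w powr of_real \<mu> * P w) has_field_derivative
      (of_real \<mu> * z powr (of_real \<mu> - 1) * P z + deriv P z * z powr of_real \<mu>)) (at z)"
    by (intro DERIV_mult has_field_derivative_powr powser_disc_derivative(1)[OF P] zR nz)
  \<comment> \<open>The closed form holds on the whole slit disc, an open neighbourhood of
    \<open>z\<close>, so its derivative is that of the contour integral.\<close>
  then have "((\<lambda>w. contour_integral (linepath 0 w)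
       (\<lambda>\<zeta>. \<zeta> powr (of_real \<tau> - 1) * f \<zeta> * (w - \<zeta>) powr (- of_real (\<tau> - \<mu>)))) has_field_derivative
      (of_real \<mu> * z powr (of_real \<mu> - 1) * P z + deriv P z * z powr of_real \<mu>)) (at z)"
    by (rule has_field_derivative_transform_within_open[where S = "ball 0 1 - \<real>\<^sub>\<le>\<^sub>0"])
      (use z contour in \<open>auto intro: open_Diff\<close>)
  note D = DERIV_imp_deriv[OF this]
  have 4: "z powr (1 - of_real \<mu>) * z powr (of_real \<mu> - 1) = 1"
    using z0 by (simp flip: powr_add)
  have 5: "z powr (1 - of_real \<mu>) * z powr of_real \<mu> = z"
    using z0 by (simp flip: powr_add)
  have "z powr (1 - of_real \<mu>) * (of_real \<mu> * z powr (of_real \<mu> - 1) * P z + deriv P z * z powr of_real \<mu>)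
      = (z powr (1 - of_real \<mu>) * z powr (of_real \<mu> - 1)) * of_real \<mu> * P z
       + (z powr (1 - of_real \<mu>) * z powr of_real \<mu>) * deriv P z"
    by (simp add: algebra_simps)
  also have "\<dots> = of_real \<mu> * P z + z * deriv P z" by (simp add: 4 5)
  finally have "tremblay_formula \<tau> \<mu> f z =
      K * (of_real \<mu> * P z + z * deriv P z)"
    unfolding tremblay_formula_def frac_deriv_def D K_def s_def by (simp add: mult_ac)
  with c_sums[OF nz] show "(\<lambda>n. c n * z ^ n) sums tremblay_formula \<tau> \<mu> f z" by simp
qed

text \<open>The operator is defined by choice. The power series shows that an analytic extension
  exists, and the identity theorem forces the chosen extension to agree with it on the whole
  disc.\<close>

lemma tremblay_sums:
  fixes b :: "nat \<Rightarrow> complex"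
  assumes \<tau>: "0 < \<tau>" and \<mu>: "0 < \<mu>" and \<sigma>: "\<tau> - \<mu> < 1"
    and f: "\<And>z. norm z < 1 \<Longrightarrow> (\<lambda>n. b n * z ^ n) sums f z" and z: "norm z < 1"
  shows "(\<lambda>n. of_real (Gamma \<mu> / Gamma \<tau> * (Gamma (real n + \<tau>) / Gamma (real n + \<mu>))) * b n * z ^ n)
           sums tremblay \<tau> \<mu> f z"
proof -
  define c where "c = (\<lambda>n. of_real (Gamma \<mu> / Gamma \<tau> * (Gamma (real n + \<tau>) / Gamma (real n + \<mu>))) * b n)"
  define T where "T = (\<lambda>z. \<Sum>n. c n * z ^ n)"
  let ?S = "ball 0 1 - \<real>\<^sub>\<le>\<^sub>0 :: complex set"
  have formula: "(\<lambda>n. c n * z ^ n) sums tremblay_formula \<tau> \<mu> f z" if "z \<in> ?S" for z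
    unfolding c_def by (rule tremblay_formula_sums(1)[OF \<tau> \<mu> \<sigma> f that])
  \<comment> \<open>A concrete point of the slit disc: it instantiates the summability result and
    gives the nonempty set for the identity theorem.\<close>
  have half: "(1/2 :: complex) \<in> ?S" by (auto simp: complex_nonpos_Reals_iff)
  have T: "(\<lambda>n. c n * z ^ n) sums T z" if "norm z < 1" for z
    unfolding T_def c_def by (rule summable_sums, rule tremblay_formula_sums(2)[OF \<tau> \<mu> \<sigma> f half that])
  let ?ext = "\<lambda>T. T holomorphic_on ball 0 1 \<and> (\<forall>z\<in>?S. T z = tremblay_formula \<tau> \<mu> f z)"
  have T_ext: "?ext T"
    using powser_disc_holomorphic[OF T] formula unfolding T_def
    by (blast intro: sums_unique[symmetric])
  then have ext: "?ext (tremblay \<tau> \<mu> f)"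
    unfolding tremblay_def by (rule someI[of ?ext])
  have "T z = tremblay \<tau> \<mu> f z"
  proof (rule analytic_continuation_open[of ?S "ball 0 1" T "tremblay \<tau> \<mu> f"])
    show "open ?S" by (intro open_Diff open_ball) simp
    show "?S \<noteq> {}" using half by blast
    show "T w = tremblay \<tau> \<mu> f w" if "w \<in> ?S" for w
      using T_ext ext that by simp
  qed (use T_ext ext z in auto)
  with T[OF z] show ?thesis by (simp add: c_def)
qed

section \<open>The coefficient estimate for the class\<close>

text \<open>Passing from m to m + 1 multiplies the ratio by (y + m)/(x + m), which is at least
  1.\<close>

lemma incseq_pochhammer_ratio:
  fixes x y :: real
  assumes "0 < x" "x \<le> y"
  shows "incseq (\<lambda>m. pochhammer y m / pochhammer x m)"
proof (rule incseq_SucI)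
  fix m
  have "pochhammer x m > 0" "pochhammer y m > 0"
    using assms by (auto intro: pochhammer_pos)
  moreover have "1 \<le> (y + real m) / (x + real m)"
    using assms by (simp add: field_simps)
  ultimately have "pochhammer y m / pochhammer x m * 1 \<le>
      pochhammer y m / pochhammer x m * ((y + real m) / (x + real m))"
    by (intro mult_left_mono) auto
  then show "pochhammer y m / pochhammer x m \<le> pochhammer y (Suc m) / pochhammer x (Suc m)"
    by (simp add: pochhammer_Suc)
qed

text \<open>The index is shifted so that \<open>a n\<close> belongs to degree n + k + 1. Bounding
  every partial sum avoids any convergence claim on the unit circle and is enough for estimating
  f(z) - z.\<close>

lemma class_P_tremblay_coeff_bound:
  assumes k: "k \<ge> 1" and \<tau>: "0 < \<tau>" and \<mu>: "0 < \<mu>" and \<mu>\<tau>: "\<mu> \<le> \<tau>" and \<sigma>: "\<tau> - \<mu> < 1"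
    and \<delta>: "0 \<le> \<delta>" and f: "f \<in> class_P_tremblay \<tau> \<mu> k \<delta> \<gamma>"
  obtains a :: "nat \<Rightarrow> real" where "\<And>n. 0 \<le> a n"
    "\<And>z. norm z < 1 \<Longrightarrow> (\<lambda>n. of_real (a n) * z ^ (n + (k + 1))) sums (z - f z)"
    "\<And>N. (\<Sum>n<N. a n) \<le>
       (1 - \<gamma>) * pochhammer (\<mu> + 1) k / ((1 + \<delta> * real k) * pochhammer (\<tau> + 1) k)"
proof -
  from f obtain \<alpha> where \<alpha>0: "\<forall>\<nu>\<ge>k+1. 0 \<le> \<alpha> \<nu>" and
    \<alpha>: "\<forall>z\<in>ball 0 1. summable (\<lambda>n. complex_of_real (\<alpha> (n + (k+1))) * z ^ (n + (k+1))) \<and>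
           f z = z - (\<Sum>n. complex_of_real (\<alpha> (n + (k+1))) * z ^ (n + (k+1)))"
    unfolding class_P_tremblay_def class_P_def by blast
  define a where "a = (\<lambda>n. \<alpha> (n + (k+1)))"
  have a0: "0 \<le> a n" for n using \<alpha>0 by (simp add: a_def)
  have a_sums: "(\<lambda>n. of_real (a n) * z ^ (n + (k + 1))) sums (z - f z)" if "norm z < 1" for z
    using \<alpha> that by (auto simp: a_def sums_iff)
  \<comment> \<open>The full coefficient sequence of \<open>f\<close>. Since k \<ge> 1, the degree 1
    term lies below the tail.\<close>
  define b where "b = (\<lambda>n. if n = 1 then 1 else if n \<ge> k + 1 then - a (n - (k + 1)) else 0)"
  have b_shift: "b (n + (k + 1)) = - a n" for n using k by (simp add: b_def)
  have b_init: "b n = (if n = 1 then 1 else 0)" if "n < k + 1" for n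
    using that by (simp add: b_def)
  have f_sums: "(\<lambda>n. complex_of_real (b n) * z ^ n) sums f z" if "norm z < 1" for z
  proof -
    have "(\<lambda>n. complex_of_real (b (n + (k + 1))) * z ^ (n + (k + 1))) sums (f z - z)"
      using sums_minus[OF a_sums[OF that]] unfolding b_shift by simp
    note this[THEN iffD1[OF sums_iff_shift]]
    also have "(\<Sum>n<k+1. complex_of_real (b n) * z ^ n) = (\<Sum>n<k+1. if n = 1 then z else 0)"
      by (intro sum.cong) (auto simp: b_init)
    also have "\<dots> = z" using k by simp
    finally show ?thesis by simp
  qed
  define T where "T = tremblay \<tau> \<mu> f"
  define t where "t = (\<lambda>n. complex_of_real (Gamma \<mu> / Gamma \<tau> * (Gamma (real n + \<tau>) / Gamma (real n + \<mu>))) * of_real (b n))"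
  have T_sums: "(\<lambda>n. t n * z ^ n) sums T z" if "norm z < 1" for z
    unfolding T_def t_def by (rule tremblay_sums[OF \<tau> \<mu> \<sigma> f_sums that])
  have T_holo: "T holomorphic_on ball 0 1" by (rule powser_disc_holomorphic[OF T_sums])
  define C where "C = Gamma (\<mu> + 1) * Gamma \<tau> / (Gamma (\<tau> + 1) * Gamma \<mu>)"
  define H where "H = (\<lambda>w. complex_of_real C * inverse w *
           ((1 - complex_of_real \<delta>) * T w + complex_of_real \<delta> * w * deriv T w))"
  \<comment> \<open>\<open>H\<close> is analytic off 0, so at positive radii
    \<open>remove_sings\<close> leaves its value unchanged.\<close>
  have H_gt: "Re (H (of_real r)) > \<gamma>" if r: "0 < r" "r < 1" for r
  proof -
    have "H holomorphic_on ball 0 1 - {0}"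
      unfolding H_def
      by (intro holomorphic_intros holomorphic_on_subset[OF T_holo]
          holomorphic_on_subset[OF holomorphic_deriv[OF T_holo]]) auto
    then have "H analytic_on ball 0 1 - {0}"
      by (subst analytic_on_open) auto
    then have "H analytic_on {of_real r}"
      by (rule analytic_on_subset) (use r in auto)
    then have "remove_sings H (of_real r) = H (of_real r)"
      by (rule remove_sings_at_analytic)
    moreover have "\<forall>z\<in>ball 0 1. Re (remove_sings H z) > \<gamma>"
      using f unfolding class_P_tremblay_def H_def C_def T_def mem_Collect_eq by (rule conjunct2)
    moreover have "complex_of_real r \<in> ball 0 1" using r by simp
    ultimately show ?thesis by fastforce
  qed
  \<comment> \<open>The factor by which the whole expression in the class condition multiplies the
    coefficient of degree n. The constant \<open>C\<close> normalises it so that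
    \<open>q 1 = 1\<close>, which also shifts the Pochhammer bases to \<tau> + 1 and \<mu> +
    1.\<close>
  define q where "q = (\<lambda>n. (1 - \<delta> + \<delta> * real n) * (C * (Gamma \<mu> / Gamma \<tau> * (Gamma (real n + \<tau>) / Gamma (real n + \<mu>)))))"
  have q_Suc: "q (Suc m) = (1 + \<delta> * real m) * (pochhammer (\<tau> + 1) m / pochhammer (\<mu> + 1) m)" for m
  proof -
    have "\<tau> + 1 \<notin> \<int>\<^sub>\<le>\<^sub>0" "\<mu> + 1 \<notin> \<int>\<^sub>\<le>\<^sub>0"
      using \<tau> \<mu> by (auto dest: nonpos_Ints_nonpos)
    moreover have "Gamma \<tau> > 0" "Gamma \<mu> > 0" using \<tau> \<mu> by (auto intro: Gamma_real_pos)
    ultimately show ?thesis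
      by (simp add: q_def C_def pochhammer_Gamma algebra_simps)
  qed
  have H_sums: "(\<lambda>n. q n * b n * r ^ n / r) sums Re (H (of_real r))" if r: "0 < r" "r < 1" for r
  proof -
    have nr: "norm (complex_of_real r) < 1" using r by simp
    have "(\<lambda>n. of_real C * inverse (of_real r) * ((1 - of_real \<delta>) * (t n * of_real r ^ n)
        + of_real \<delta> * (of_nat n * t n * of_real r ^ n)))
      sums H (of_real r)"
      unfolding H_def mult.assoc[of "of_real \<delta>" "of_real r"]
      by (intro sums_mult sums_add T_sums powser_disc_derivative(2)[OF T_sums] nr)
    also have "(\<lambda>n. of_real C * inverse (of_real r) * ((1 - of_real \<delta>) * (t n * of_real r ^ n)
        + of_real \<delta> * (of_nat n * t n * of_real r ^ n))) = (\<lambda>n. complex_of_real (q n * b n * r ^ n / r))"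
      by (rule ext) (simp add: t_def q_def algebra_simps divide_inverse)
    finally show ?thesis
      using sums_Re by fastforce
  qed
  \<comment> \<open>At a real radius, Re H(r) is 1, coming from degree 1, minus a series with
    nonnegative terms. Each partial sum of that series is therefore at most 1 - Re H(r), which is
    below 1 - \<gamma>.\<close>
  have part: "(\<Sum>n<N. q (n + (k + 1)) * a n * r ^ (n + k)) \<le> 1 - \<gamma>" if r: "0 < r" "r < 1" for r N
  proof -
    have "q 1 = 1" using q_Suc[of 0] by simp
    then have "(\<Sum>n<k+1. q n * b n * r ^ n / r) = (\<Sum>n<k+1. if n = 1 then 1 else 0)"
      using r by (intro sum.cong) (auto simp: b_init)
    also have "\<dots> = 1" using k by simp
    finally have init: "(\<Sum>n<k+1. q n * b n * r ^ n / r) = 1" .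
    have "(\<lambda>n. q (n + (k + 1)) * b (n + (k + 1)) * r ^ (n + (k + 1)) / r) sums (Re (H (of_real r)) - 1)"
      by (rule iffD2[OF sums_iff_shift]) (simp only: init diff_add_cancel H_sums[OF r])
    from sums_minus[OF this] have *: "(\<lambda>n. q (n + (k + 1)) * a n * r ^ (n + k)) sums (1 - Re (H (of_real r)))"
      unfolding b_shift using r by (simp add: mult.assoc)
    have "q (n + (k + 1)) \<ge> 0" for n
      using q_Suc[of "n + k"] \<tau> \<mu> \<delta> by (auto intro!: mult_nonneg_nonneg divide_nonneg_nonneg pochhammer_nonneg)
    then have "(\<Sum>n<N. q (n + (k + 1)) * a n * r ^ (n + k)) \<le> 1 - Re (H (of_real r))"
      using sum_le_suminf[OF sums_summable[OF *], of "{..<N}"] a0 r by (simp add: sums_unique[OF *])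
    with H_gt[OF r] show ?thesis by simp
  qed
  \<comment> \<open>For fixed \<open>N\<close> the sum is a polynomial in r, so letting r tend to 1
    from the left needs only continuity.\<close>
  have bound: "(\<Sum>n<N. q (n + (k + 1)) * a n) \<le> 1 - \<gamma>" for N
  proof (rule tendsto_upperbound)
    show "((\<lambda>r. \<Sum>n<N. q (n + (k + 1)) * a n * r ^ (n + k)) \<longlongrightarrow> (\<Sum>n<N. q (n + (k + 1)) * a n)) (at_left 1)"
      by (rule tendsto_eq_intros refl | simp)+
    show "\<forall>\<^sub>F r in at_left (1::real). (\<Sum>n<N. q (n + (k + 1)) * a n * r ^ (n + k)) \<le> 1 - \<gamma>"
      by (rule eventually_mono[OF eventually_at_left_real[OF zero_less_one]]) (use part in auto)
  qed simp
  have pos: "pochhammer (\<tau> + 1) k > 0" "pochhammer (\<mu> + 1) k > 0" "1 + \<delta> * real k > 0"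
    using \<tau> \<mu> \<delta> by (auto intro!: pochhammer_pos add_pos_nonneg)
  \<comment> \<open>Both factors of the weight are nonnegative and nondecreasing in the degree, so
    the first weight of the tail is the smallest.\<close>
  have q_le: "q (k + 1) \<le> q (n + (k + 1))" for n
  proof -
    have "pochhammer (\<tau> + 1) k / pochhammer (\<mu> + 1) k
        \<le> pochhammer (\<tau> + 1) (n + k) / pochhammer (\<mu> + 1) (n + k)"
      using \<mu> \<mu>\<tau> by (intro incseqD[OF incseq_pochhammer_ratio]) auto
    moreover have "1 + \<delta> * real k \<le> 1 + \<delta> * real (n + k)"
      using \<delta> by (intro add_left_mono mult_left_mono) auto
    ultimately have "q (Suc k) \<le> q (Suc (n + k))"
      unfolding q_Suc using pos \<delta> by (intro mult_mono) auto
    then show ?thesis by simp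
  qed
  have "(\<Sum>n<N. a n) \<le>
       (1 - \<gamma>) * pochhammer (\<mu> + 1) k / ((1 + \<delta> * real k) * pochhammer (\<tau> + 1) k)" for N
  proof -
    have "q (k + 1) * (\<Sum>n<N. a n) \<le> (\<Sum>n<N. q (n + (k + 1)) * a n)"
      unfolding sum_distrib_left by (intro sum_mono mult_right_mono q_le a0)
    also note bound
    finally have "(1 + \<delta> * real k) * pochhammer (\<tau> + 1) k / pochhammer (\<mu> + 1) k * (\<Sum>n<N. a n) \<le> 1 - \<gamma>"
      using q_Suc[of k] by simp
    moreover have "(1 + \<delta> * real k) * pochhammer (\<tau> + 1) k > 0"
      using pos by simp
    ultimately show ?thesis
      using pos(2) by (simp add: pos_le_divide_eq pos_divide_le_eq mult_ac)
  qed
  with that a0 a_sums show ?thesis by blast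
qed

section \<open>Growth bounds for functions of the class\<close>

theorem theorem3:
  fixes k :: nat and \<tau> \<mu> \<delta> \<gamma> :: real and f :: "complex \<Rightarrow> complex" and z :: complex
  assumes "k \<ge> 1"
    and "0 < \<tau>" and "\<tau> \<le> 1"
    and "0 < \<mu>" and "\<mu> \<le> 1"
    and "0 \<le> \<tau> - \<mu>" and "\<tau> - \<mu> < 1"
    and "0 \<le> \<delta>" and "\<delta> < 1"
    and "0 \<le> \<gamma>" and "\<gamma> < 1"
    and "\<tau> - \<mu> + \<gamma> < 1"
    and "f \<in> class_P_tremblay \<tau> \<mu> k \<delta> \<gamma>"
    and "z \<in> ball 0 1"
  shows "cmod z - cmod z ^ (k + 1) *
           ((1 - \<gamma>) * pochhammer (\<mu> + 1) k / ((1 + \<delta> * real k) * pochhammer (\<tau> + 1) k))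
           \<le> cmod (f z)
       \<and> cmod (f z) \<le> cmod z + cmod z ^ (k + 1) *
           ((1 - \<gamma>) * pochhammer (\<mu> + 1) k / ((1 + \<delta> * real k) * pochhammer (\<tau> + 1) k))"
proof -
  let ?M = "(1 - \<gamma>) * pochhammer (\<mu> + 1) k / ((1 + \<delta> * real k) * pochhammer (\<tau> + 1) k)"
  have z: "norm z < 1" using assms(14) by simp
  have "\<mu> \<le> \<tau>" using assms(6) by simp
  then obtain a :: "nat \<Rightarrow> real" where a0: "\<And>n. 0 \<le> a n"
    and a_sums: "\<And>z. norm z < 1 \<Longrightarrow> (\<lambda>n. of_real (a n) * z ^ (n + (k + 1))) sums (z - f z)"
    and a_le: "\<And>N. (\<Sum>n<N. a n) \<le> ?M"
    by (rule class_P_tremblay_coeff_bound[OF assms(1,2,4) _ assms(7,8,13)]) blast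
  \<comment> \<open>Each power in the tail satisfies |z|^(n+k+1) \<le> |z|^(k+1); the resulting
    bound on partial sums passes to the limit. Both required inequalities then follow from the
    reverse triangle inequality.\<close>
  have "norm (z - f z) \<le> norm z ^ (k + 1) * ?M"
  proof (rule Lim_bounded)
    show "(\<lambda>N. norm (\<Sum>n<N. of_real (a n) * z ^ (n + (k + 1)))) \<longlonglongrightarrow> norm (z - f z)"
      using a_sums[OF z] unfolding sums_def by (rule tendsto_norm)
    have "norm (\<Sum>n<N. of_real (a n) * z ^ (n + (k + 1))) \<le> norm z ^ (k + 1) * ?M" for N
    proof -
      have "norm (\<Sum>n<N. of_real (a n) * z ^ (n + (k + 1))) \<le> (\<Sum>n<N. norm z ^ (k + 1) * a n)"
      proof (rule sum_norm_le)
        fix n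
        have "norm (of_real (a n) * z ^ (n + (k + 1))) = norm z ^ (n + (k + 1)) * a n"
          using a0[of n] by (simp add: norm_mult norm_power)
        also have "\<dots> \<le> norm z ^ (k + 1) * a n"
          using z by (intro mult_right_mono power_decreasing a0) auto
        finally show "norm (of_real (a n) * z ^ (n + (k + 1))) \<le> norm z ^ (k + 1) * a n" .
      qed
      also have "\<dots> \<le> norm z ^ (k + 1) * ?M"
        unfolding sum_distrib_left[symmetric] by (intro mult_left_mono a_le) simp
      finally show ?thesis .
    qed
    then show "\<forall>N\<ge>0. norm (\<Sum>n<N. of_real (a n) * z ^ (n + (k + 1))) \<le> norm z ^ (k + 1) * ?M" by blast
  qed
  moreover have "norm z - norm (f z) \<le> norm (z - f z)" "norm (f z) - norm z \<le> norm (z - f z)"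
    using norm_triangle_ineq2[of z "f z"] norm_triangle_ineq2[of "f z" z]
    by (simp_all add: norm_minus_commute)
  ultimately show ?thesis by linarith
qed

end
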